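(* Let $S\subset \Pi_m$. Then $\delta(S)=\delta'(S)$.
   Context: Let $[n]=\{1,\dots,n\}$. A partition of $[n]$ into disjoint nonempty blocks $B_1/B_2/\cdots/B_t$, ordered so that $\min B_1<\min B_2<\cdots<\min B_t$, is identified with the word $\pi_1\pi_2\cdots\pi_n$ where $\pi_i=j$ iff $i\in B_j$. The canonization of a word is obtained by replacing all occurrences of the first letter by 1, all occurrences of the second distinct letter to appear by 2, and so on; partitions of $[n]$ correspond exactly to canonized words of length $n$. $\Pi_n$ is the set of all partitions of $[n]$ (as words) and $\Pi_{n,k}$ is the set of partitions of $[n]$ with at most $k$ blocks. For $S\subset\Pi_m$ and a word $\sigma=\sigma_1\cdots\sigma_n$, $\nu(S,\sigma)$ is the number of copies of patterns of $S$ in $\sigma$ in the unrestricted sense: the number of choices of positions $i_1<\cdots<i_m$ such that the canonization of $\sigma_{i_1}\cdots\sigma_{i_m}$ belongs to $S$. Define, for $n\ge m$, $$\delta(S,n,k)=\frac{\max\{\nu(S,\pi):\pi\in\Pi_{n,k}\}}{\binom nm},$$ and $$\delta(S)=\lim_{n\to\infty}\lim_{k\to\infty}\delta(S,n,k),\qquad \delta'(S)=\lim_{k\to\infty}\lim_{n\to\infty}\delta(S,n,k);$$ these limits exist. *)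

theory Defs
  imports Complex_Main "HOL-Library.Disjoint_Sets"
begin

text \<open>The letter \<open>x\<close> is replaced by \<open>j\<close> when it is the \<open>j\<close>-th distinct letter to appear, i.e. when
  \<open>j - 1\<close> distinct letters occur before the first \<open>x\<close>.\<close>

definition canonize :: "'a list \<Rightarrow> nat list" where
  "canonize w = map (\<lambda>x. Suc (card (set (takeWhile (\<lambda>y. y \<noteq> x) w)))) w"

text \<open>With blocks \<open>B\<^sub>1, \<dots>, B\<^sub>t\<close> listed by increasing minimum, the block \<open>B\<close> is \<open>B\<^sub>j\<close> when exactly \<open>j\<close>
  blocks have minimum at most \<open>Min B\<close>. Letter \<open>i\<close> of the word (for \<open>i\<close> from 1 to \<open>n\<close>) is at list
  index \<open>i - 1\<close>.\<close>

definition partition_word :: "nat \<Rightarrow> nat set set \<Rightarrow> nat list" where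
  "partition_word n P =
     map (\<lambda>i. card {B \<in> P. Min B \<le> Min (THE C. C \<in> P \<and> i \<in> C)}) [1..<Suc n]"

definition partitions :: "nat \<Rightarrow> nat list set" where
  "partitions n = partition_word n ` {P. partition_on {1..n} P}"

definition partitions_le :: "nat \<Rightarrow> nat \<Rightarrow> nat list set" where
  "partitions_le n k = partition_word n ` {P. partition_on {1..n} P \<and> card P \<le> k}"

text \<open>The pattern length \<open>m\<close> is an explicit argument, since it cannot be read off from an empty \<open>S\<close>.
  The set \<open>I\<close> collects the (0-based) positions of the chosen subword.\<close>

definition copies :: "nat \<Rightarrow> nat list set \<Rightarrow> 'a list \<Rightarrow> nat" where
  "copies m S w = card {I. I \<subseteq> {..<length w} \<and> card I = m \<and> canonize (nths w I) \<in> S}"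

text \<open>Meaningful for \<open>m \<le> n\<close> and \<open>1 \<le> k\<close>; other values do not affect the limits below.\<close>

definition max_density :: "nat \<Rightarrow> nat list set \<Rightarrow> nat \<Rightarrow> nat \<Rightarrow> real" where
  "max_density m S n k = real (Max (copies m S ` partitions_le n k)) / real (n choose m)"

definition packing_density :: "nat \<Rightarrow> nat list set \<Rightarrow> real" where
  "packing_density m S = lim (\<lambda>n. lim (\<lambda>k. max_density m S n k))"

definition packing_density' :: "nat \<Rightarrow> nat list set \<Rightarrow> real" where
  "packing_density' m S = lim (\<lambda>k. lim (\<lambda>n. max_density m S n k))"

text \<open>The remainder shows that partitions of \<open>[n]\<close> correspond exactly to canonized words of length
  \<open>n\<close>, the number of blocks being the number of distinct letters (\<open>partitions_eq\<close>,
  \<open>partitions_le_eq\<close>).\<close>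

lemma length_partition_word[simp]: "length (partition_word n P) = n" by (simp add: partition_word_def)

definition blk where "blk P i = (THE C. C \<in> P \<and> i \<in> C)"
lemma blk: assumes "partition_on A P" "i \<in> A" shows "blk P i \<in> P" "i \<in> blk P i"
proof -
  have "\<exists>!C. C \<in> P \<and> i \<in> C" using assms unfolding partition_on_def disjoint_def by blast
  from theI'[OF this] show "blk P i \<in> P" "i \<in> blk P i" by (auto simp: blk_def)
qed
lemma blk_eq: assumes "partition_on A P" "C \<in> P" "i \<in> C" shows "blk P i = C"
  using assms blk[OF assms(1), of i] unfolding partition_on_def disjoint_def by blast

lemma canonize_nth: "i < length w \<Longrightarrow> canonize w ! i = Suc (card (set (takeWhile (\<lambda>y. y \<noteq> w!i) w)))"
  by (simp add: canonize_def)

lemma canonize_partition_word: assumes P: "partition_on {1..n} P" 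
  shows "canonize (partition_word n P) = partition_word n P" "card (set (partition_word n P)) = card P"
proof -
  let ?w = "partition_word n P"
  let ?r = "\<lambda>C. card {B\<in>P. Min B \<le> Min C}"
  have fP: "finite P" using P finite_elements by blast
  have fB: "\<And>B. B \<in> P \<Longrightarrow> finite B \<and> B \<noteq> {} \<and> B \<subseteq> {1..n}"
    using P unfolding partition_on_def by (metis Union_upper finite_atLeastAtMost finite_subset)
  have minin: "\<And>B. B \<in> P \<Longrightarrow> Min B \<in> B" using fB by (simp)
  have minj: "\<And>B C. B \<in> P \<Longrightarrow> C \<in> P \<Longrightarrow> Min B = Min C \<Longrightarrow> B = C"
    using minin blk_eq[OF P] by metis
  have rmono: "?r B < ?r C" if "B \<in> P" "C \<in> P" "Min B < Min C" for B C
  proof (rule psubset_card_mono)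
    show "{Ba \<in> P. Min Ba \<le> Min B} \<subset> {B \<in> P. Min B \<le> Min C}" using that by force
  qed (use fP in auto)
  have rinj: "B = C" if "B \<in> P" "C \<in> P" "?r B = ?r C" for B C
  proof (rule ccontr)
    assume "B \<noteq> C"
    then have "Min B \<noteq> Min C" using minj[OF that(1,2)] by blast
    then have "Min B < Min C \<or> Min C < Min B" by linarith
    then show False using rmono[OF that(1,2)] rmono[OF that(2,1)] that(3) by auto
  qed
  have wn: "?w ! j = ?r (blk P (Suc j))" if "j < n" for j
    using that by (simp add: partition_word_def blk_def del: upt_Suc)
  have sw: "set ?w = ?r ` P"
  proof -
    have "set ?w = (\<lambda>i. ?r (blk P i)) ` {1..n}" by (auto simp: partition_word_def blk_def)
    also have "\<dots> = ?r ` (blk P ` {1..n})" by auto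
    also have "blk P ` {1..n} = P"
    proof
      show "blk P ` {1..n} \<subseteq> P" using blk[OF P] by auto
      show "P \<subseteq> blk P ` {1..n}"
      proof
        fix B assume "B \<in> P"
        then have "blk P (Min B) = B" "Min B \<in> {1..n}" using blk_eq[OF P] minin fB by (blast, blast)
        then show "B \<in> blk P ` {1..n}" by (metis imageI)
      qed
    qed
    finally show ?thesis .
  qed
  show "card (set ?w) = card P" unfolding sw
    by (rule card_image) (rule inj_onI, rule rinj, simp_all)
  show "canonize ?w = ?w"
  proof (rule nth_equalityI)
    fix i assume "i < length (canonize ?w)"
    then have i: "i < n" by (simp add: canonize_def)
    let ?C = "blk P (Suc i)"
    have C: "?C \<in> P" "Suc i \<in> ?C" using blk[OF P, of "Suc i"] i by auto
    define m where "m = Min ?C - 1"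
    have mC: "Suc m = Min ?C" "m < n" using minin[OF C(1)] fB[OF C(1)] unfolding m_def by fastforce+
    have wm: "?w ! m = ?w ! i" using wn[of m] wn[OF i] mC minin[OF C(1)] blk_eq[OF P C(1)] by metis
    have bef: "?w ! j \<noteq> ?w ! i" if "j < m" for j
    proof
      assume "?w ! j = ?w ! i"
      then have "?r (blk P (Suc j)) = ?r ?C" using wn[of j] wn[OF i] that mC by simp
      then have "blk P (Suc j) = ?C" using rinj blk[OF P, of "Suc j"] C that mC by auto
      then have "Suc j \<in> ?C" using blk(2)[OF P, of "Suc j"] that mC by auto
      then have "Min ?C \<le> Suc j" using fB[OF C(1)] by simp
      then show False using that mC by simp
    qed
    have tw: "takeWhile (\<lambda>y. y \<noteq> ?w ! i) ?w = take m ?w"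
      by (rule takeWhile_eq_take_P_nth) (use wm bef mC in auto)
    have "set (take m ?w) = ?r ` {B \<in> P. Min B < Min ?C}"
    proof
      show "set (take m ?w) \<subseteq> ?r ` {B \<in> P. Min B < Min ?C}"
      proof
        fix x assume "x \<in> set (take m ?w)"
        then obtain j where j: "j < m" "x = ?w ! j" by (auto simp: in_set_conv_nth)
        have b: "blk P (Suc j) \<in> P" "Suc j \<in> blk P (Suc j)" using blk[OF P, of "Suc j"] j mC by auto
        then have "Min (blk P (Suc j)) \<le> Suc j" using fB by auto
        then show "x \<in> ?r ` {B \<in> P. Min B < Min ?C}" using b j wn[of j] mC by auto
      qed
      show "?r ` {B \<in> P. Min B < Min ?C} \<subseteq> set (take m ?w)"
      proof
        fix x assume "x \<in> ?r ` {B \<in> P. Min B < Min ?C}"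
        then obtain B where B: "B \<in> P" "Min B < Min ?C" "x = ?r B" by auto
        have 1: "Min B \<ge> 1" using minin[OF B(1)] fB[OF B(1)] by auto
        then have "Min B - 1 < m" using B mC by auto
        moreover have "?w ! (Min B - 1) = x" using wn[of "Min B - 1"] 1 B mC blk_eq[OF P B(1) minin[OF B(1)]] by auto
        ultimately show "x \<in> set (take m ?w)" using mC by (auto simp: in_set_conv_nth intro!: exI[of _ "Min B - 1"])
      qed
    qed
    moreover have "card (?r ` {B \<in> P. Min B < Min ?C}) = card {B \<in> P. Min B < Min ?C}"
      by (rule card_image) (rule inj_onI, rule rinj, simp_all)
    moreover have "{B \<in> P. Min B \<le> Min ?C} = insert ?C {B \<in> P. Min B < Min ?C}"
      using minj[OF _ C(1)] C by (auto simp: order_le_less)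
    ultimately have "Suc (card (set (take m ?w))) = ?r ?C" using fP by simp
    moreover have "canonize ?w ! i = Suc (card (set (take m ?w)))"
      using canonize_nth[of i ?w] i unfolding tw by simp
    ultimately show "canonize ?w ! i = ?w ! i" using wn[OF i] by simp
  qed (simp add: canonize_def)
qed

lemma partition_word_canonized: assumes c: "canonize w = w" and n: "length w = n"
  shows "\<exists>P. partition_on {1..n} P \<and> partition_word n P = w"
proof -
  define blkf where "blkf i = {j\<in>{1..n}. w!(j-1) = w!(i-1)}" for i
  define P where "P = blkf ` {1..n}"
  have P: "partition_on {1..n} P" unfolding partition_on_def disjoint_def P_def blkf_def by auto
  have be: "blk P i = blkf i" if "i \<in> {1..n}" for i
    by (rule blk_eq[OF P]) (use that in \<open>auto simp: P_def blkf_def\<close>)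
  let ?v = "partition_word n P"
  have vn: "?v ! j = card {B\<in>P. Min B \<le> Min (blk P (Suc j))}" if "j < n" for j
    using that by (simp add: partition_word_def blk_def del: upt_Suc)
  have eq: "?v ! i = ?v ! j \<longleftrightarrow> w ! i = w ! j" if ij: "i < n" "j < n" for i j
  proof
    assume "w ! i = w ! j"
    then have "blkf (Suc i) = blkf (Suc j)" by (simp add: blkf_def)
    then show "?v ! i = ?v ! j" using vn be ij by simp
  next
    assume a: "?v ! i = ?v ! j"
    let ?r = "\<lambda>C. {B\<in>P. Min B \<le> Min C}"
    have fin: "finite (?r C)" for C by (simp add: P_def)
    have c: "card (?r (blk P (Suc i))) = card (?r (blk P (Suc j)))" using a vn ij by simp
    have "?r (blk P (Suc i)) = ?r (blk P (Suc j))"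
    proof (cases "Min (blk P (Suc i)) \<le> Min (blk P (Suc j))")
      case True
      then have "?r (blk P (Suc i)) \<subseteq> ?r (blk P (Suc j))" by auto
      from card_subset_eq[OF fin this c] show ?thesis .
    next
      case False
      then have "?r (blk P (Suc j)) \<subseteq> ?r (blk P (Suc i))" by auto
      from card_subset_eq[OF fin this c[symmetric]] show ?thesis by simp
    qed
    moreover have "blk P (Suc i) \<in> P" "blk P (Suc j) \<in> P" using blk[OF P] ij by auto
    ultimately have "Min (blk P (Suc i)) = Min (blk P (Suc j))" by (auto intro: antisym)
    then have e: "Min (blkf (Suc i)) = Min (blkf (Suc j))" using be ij by simp
    have min: "Min (blkf l) \<in> blkf l" if "l \<in> {1..n}" for l
      by (rule Min_in) (use that in \<open>auto simp: blkf_def\<close>)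
    have "w ! (Min (blkf (Suc l)) - 1) = w ! l" if "l < n" for l
    proof -
      have "Suc l \<in> {1..n}" using that by simp
      from min[OF this] have "Min (blkf (Suc l)) \<in> {j\<in>{1..n}. w!(j-1) = w!(Suc l-1)}"
        by (simp only: blkf_def)
      then show ?thesis by (simp only: mem_Collect_eq diff_Suc_1)
    qed
    then show "w ! i = w ! j" using e ij by metis
  qed
  have "canonize ?v = canonize w"
  proof (rule nth_equalityI)
    fix i assume "i < length (canonize ?v)"
    then have i: "i < n" by (simp add: canonize_def)
    define g where "g = (\<lambda>x. w ! (SOME j. j < n \<and> ?v ! j = x))"
    have g: "g (?v ! j) = w ! j" if "j < n" for j
    proof -
      have "(SOME ja. ja < n \<and> ?v ! ja = ?v ! j) < n \<and> ?v ! (SOME ja. ja < n \<and> ?v ! ja = ?v ! j) = ?v ! j"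
        using that by (intro someI[of "\<lambda>ja. ja < n \<and> ?v ! ja = ?v ! j" j]) simp
      then show ?thesis using eq that unfolding g_def by metis
    qed
    have wg: "w = map g ?v" by (rule nth_equalityI) (use n g in auto)
    have gi: "inj_on g (set ?v)" using g eq by (auto simp: inj_on_def in_set_conv_nth)
    have neq: "g y \<noteq> w ! i \<longleftrightarrow> y \<noteq> ?v ! i" if "y \<in> set ?v" for y
      using inj_on_eq_iff[OF gi that, of "?v ! i"] g[OF i] i by simp
    have "takeWhile (\<lambda>y. y \<noteq> w!i) w = map g (takeWhile (\<lambda>y. y \<noteq> ?v!i) ?v)"
    proof -
      have "takeWhile (\<lambda>y. y \<noteq> w!i) w = map g (takeWhile (\<lambda>y. g y \<noteq> w!i) ?v)"
        using takeWhile_map[of "\<lambda>y. y \<noteq> w!i" g ?v] by (simp add: wg[symmetric] o_def)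
      also have "takeWhile (\<lambda>y. g y \<noteq> w!i) ?v = takeWhile (\<lambda>y. y \<noteq> ?v!i) ?v"
        by (rule takeWhile_cong) (simp_all add: neq)
      finally show ?thesis .
    qed
    moreover have "inj_on g (set (takeWhile (\<lambda>y. y \<noteq> ?v!i) ?v))"
      by (rule inj_on_subset[OF gi]) (auto dest: set_takeWhileD)
    ultimately have "card (set (takeWhile (\<lambda>y. y \<noteq> w!i) w)) = card (set (takeWhile (\<lambda>y. y \<noteq> ?v!i) ?v))"
      by (simp add: card_image)
    then show "canonize ?v ! i = canonize w ! i" using i n by (simp add: canonize_nth)
  qed (simp add: canonize_def n)
  then show ?thesis using P canonize_partition_word(1)[OF P] c by auto
qed

lemma partitions_eq: "partitions n = {w. length w = n \<and> canonize w = w}"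
  unfolding partitions_def using partition_word_canonized canonize_partition_word by force
lemma partitions_le_eq: "partitions_le n k = {w \<in> partitions n. card (set w) \<le> k}"
  unfolding partitions_le_def partitions_def using canonize_partition_word by auto

end

theory Submission
  imports Defs "HOL-Library.FuncSet"
begin

text \<open>Write \<open>d n k\<close> for the maximal density of copies in words of length \<open>n\<close> with at most \<open>k\<close> letters.
  Since a word of length \<open>n\<close> has at most \<open>n\<close> letters, \<open>d n k = d n n\<close> for \<open>k \<ge> n\<close>, so the inner limit
  defining \<open>\<delta>\<close> is \<open>d n n\<close>. Averaging over the deletion of one letter shows that \<open>d n k\<close> decreases in
  \<open>n \<ge> m\<close> for every \<open>k \<ge> 1\<close> (\<open>max_density_Suc_le\<close>). Hence \<open>d n n = d n (n + 1) \<ge> d (n + 1) (n + 1)\<close>,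
  so \<open>d n n\<close> decreases to \<open>\<delta>\<close>, and for fixed \<open>k\<close> the sequence \<open>d n k \<le> d n n\<close> decreases to a limit
  \<open>L k \<le> \<delta>\<close>.

  The inequality \<open>\<delta> \<le> \<delta>'\<close> comes from a blow-up: writing every letter of an optimal word of length \<open>n\<close>
  down \<open>N\<close> times in a row multiplies the number of copies by at least \<open>N ^ m\<close> and leaves the number of
  letters at most \<open>n\<close>. Therefore \<open>d (n * N) n \<ge> c n * d n n\<close> for every \<open>N \<ge> 1\<close>, where
  \<open>c n = (n choose m) * m! / n ^ m\<close> does not involve \<open>N\<close> (\<open>max_density_blow_up\<close>). So
  \<open>c n * d n n \<le> L n \<le> \<delta>\<close>, and \<open>c n \<longlonglongrightarrow> 1\<close> squeezes \<open>L n\<close> to \<open>\<delta>\<close>. This one estimate gives both the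
  existence of the limit defining \<open>\<delta>'\<close> and its value.\<close>

section \<open>Canonization as an injective relabelling\<close>

lemma canonize_map_inj:
  assumes "inj_on g (set w)"
  shows "canonize (map g w) = canonize w"
proof -
  have "card (set (takeWhile (\<lambda>y. y \<noteq> g x) (map g w))) = card (set (takeWhile (\<lambda>y. y \<noteq> x) w))"
    if x: "x \<in> set w" for x
  proof -
    have "takeWhile (\<lambda>y. g y \<noteq> g x) w = takeWhile (\<lambda>y. y \<noteq> x) w"
      by (rule takeWhile_cong) (use assms x in \<open>auto simp: inj_on_def\<close>)
    moreover have "inj_on g (set (takeWhile (\<lambda>y. y \<noteq> x) w))"
      by (rule inj_on_subset[OF assms]) (auto dest: set_takeWhileD)
    ultimately show ?thesis by (simp add: takeWhile_map o_def card_image)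
  qed
  then show ?thesis by (simp add: canonize_def)
qed

text \<open>Of two different letters, the one that appears later has strictly more letters before its first
  occurrence.\<close>

lemma inj_on_first_occurrence_rank:
  "inj_on (\<lambda>x. Suc (card (set (takeWhile (\<lambda>y. y \<noteq> x) w)))) (set w)"
proof -
  have earlier: "card (set (takeWhile (\<lambda>z. z \<noteq> y) w)) < card (set (takeWhile (\<lambda>z. z \<noteq> x) w))"
    if y: "y \<in> set (takeWhile (\<lambda>z. z \<noteq> x) w)" for x y
  proof (rule psubset_card_mono)
    obtain as bs where ab: "takeWhile (\<lambda>z. z \<noteq> x) w = as @ y # bs" "y \<notin> set as"
      using split_list_first[OF y] by blast
    then obtain cs where "w = as @ y # cs"
      by (metis append.assoc append_Cons takeWhile_dropWhile_id)
    then have "takeWhile (\<lambda>z. z \<noteq> y) w = as"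
      using ab(2) by (auto simp: takeWhile_append)
    then show "set (takeWhile (\<lambda>z. z \<noteq> y) w) \<subset> set (takeWhile (\<lambda>z. z \<noteq> x) w)"
      using ab by auto
  qed simp
  have "y \<in> set (takeWhile (\<lambda>z. z \<noteq> x) w) \<or> x \<in> set (takeWhile (\<lambda>z. z \<noteq> y) w)"
    if "x \<in> set w" "y \<in> set w" "x \<noteq> y" for x y
    using that by (induction w) auto
  then show ?thesis
    using earlier by (intro inj_onI) (metis Suc_inject less_irrefl)
qed

lemma canonize_eq_map_inj:
  obtains g where "canonize w = map g w" "inj_on g (set w)"
  using inj_on_first_occurrence_rank[of w] unfolding canonize_def by blast

lemma canonize_in_partitions_le:
  assumes "card (set w) \<le> k"
  shows "canonize w \<in> partitions_le (length w) k"
proof -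
  obtain g where g: "canonize w = map g w" "inj_on g (set w)"
    by (rule canonize_eq_map_inj)
  then have "canonize (canonize w) = canonize w"
    by (metis canonize_map_inj)
  then show ?thesis
    using assms g by (simp add: partitions_le_eq partitions_eq card_image)
qed

section \<open>Transporting occurrences of patterns\<close>

definition occurrences :: "nat \<Rightarrow> nat list set \<Rightarrow> 'a list \<Rightarrow> nat set set" where
  "occurrences m S w = {I. I \<subseteq> {..<length w} \<and> card I = m \<and> canonize (nths w I) \<in> S}"

lemma copies_eq_card_occurrences: "copies m S w = card (occurrences m S w)"
  by (simp add: copies_def occurrences_def)

lemma finite_occurrences: "finite (occurrences m S w)"
  by (rule finite_subset[of _ "Pow {..<length w}"]) (auto simp: occurrences_def)

lemma finite_occurrence: "I \<in> occurrences m S w \<Longrightarrow> finite I"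
  by (auto simp: occurrences_def intro: finite_subset)

lemma nths_eq_map_filter: "nths w I = map ((!) w) (filter (\<lambda>i. i \<in> I) [0..<length w])"
proof -
  have "zip w [0..<length w] = map (\<lambda>i. (w ! i, i)) [0..<length w]"
    by (rule nth_equalityI) auto
  then show ?thesis
    by (simp add: nths_def filter_map o_def)
qed

lemma nths_image_strict_mono:
  assumes h: "strict_mono_on I h"
    and I: "I \<subseteq> {..<length w}"
    and v: "\<And>i. i \<in> I \<Longrightarrow> h i < length v \<and> v ! h i = w ! i"
  shows "nths v (h ` I) = nths w I"
proof -
  let ?I = "filter (\<lambda>i. i \<in> I) [0..<length w]"
  have "sorted_wrt (<) ?I"
    by (simp add: sorted_wrt_filter)
  then have "sorted_wrt (<) (map h ?I)"
    unfolding sorted_wrt_map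
    by (rule sorted_wrt_mono_rel[rotated]) (use h in \<open>auto simp: strict_mono_on_def\<close>)
  moreover have "set (map h ?I) = set (filter (\<lambda>i. i \<in> h ` I) [0..<length v])"
    using I v by auto
  ultimately have "filter (\<lambda>i. i \<in> h ` I) [0..<length v] = map h ?I"
    by (intro sorted_distinct_set_unique) (auto simp: strict_sorted_iff sorted_wrt_filter)
  then show ?thesis
    using v by (auto simp: nths_eq_map_filter)
qed

text \<open>Deleting a letter and blowing up a word both move positions by a map that is increasing on each
  surviving occurrence and preserves the letters; such a map carries occurrences to occurrences.\<close>

lemma image_in_occurrences:
  assumes I: "I \<in> occurrences m S w"
    and h: "strict_mono_on I h"
    and v: "\<And>i. i \<in> I \<Longrightarrow> h i < length v \<and> v ! h i = w ! i"
  shows "h ` I \<in> occurrences m S v"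
proof -
  have "card (h ` I) = card I"
    using h by (simp add: card_image strict_mono_on_imp_inj_on)
  moreover have "nths v (h ` I) = nths w I"
    using I h v by (intro nths_image_strict_mono) (auto simp: occurrences_def)
  ultimately show ?thesis
    using I v by (auto simp: occurrences_def)
qed

lemma copies_canonize: "copies m S (canonize w) = copies m S w"
proof -
  obtain g where g: "canonize w = map g w" "inj_on g (set w)"
    by (rule canonize_eq_map_inj)
  have "canonize (nths (map g w) I) = canonize (nths w I)" for I
    by (simp add: nths_map canonize_map_inj inj_on_subset[OF g(2) set_nths_subset])
  then show ?thesis
    by (simp add: copies_def g(1))
qed

section \<open>The maximal number of copies\<close>

definition max_copies :: "nat \<Rightarrow> nat list set \<Rightarrow> nat \<Rightarrow> nat \<Rightarrow> nat" where
  "max_copies m S n k = Max (copies m S ` partitions_le n k)"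

lemma max_density_eq: "max_density m S n k = real (max_copies m S n k) / real (n choose m)"
  by (simp add: max_density_def max_copies_def)

lemma finite_partitions_le: "finite (partitions_le n k)"
  unfolding partitions_le_def
  by (rule finite_imageI, rule finite_subset[OF _ finitely_many_partition_on[of "{1..n}"]]) auto

lemma partitions_le_nonempty:
  assumes "k \<ge> 1"
  shows "partitions_le n k \<noteq> {}"
proof -
  have "card (set (replicate n (0::nat))) \<le> k"
    using assms by (cases "n = 0") (auto simp: set_replicate_conv_if)
  from canonize_in_partitions_le[OF this] show ?thesis by auto
qed

text \<open>The maximum over partitions bounds all words on at most \<open>k\<close> letters of any alphabet, so the words
  produced below by deleting or duplicating letters need not be canonized.\<close>

lemma copies_le_max_copies:
  assumes "card (set w) \<le> k" "length w = n"
  shows "copies m S w \<le> max_copies m S n k"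
proof -
  have "canonize w \<in> partitions_le n k"
    using canonize_in_partitions_le[OF assms(1)] assms(2) by simp
  then have "copies m S (canonize w) \<le> max_copies m S n k"
    unfolding max_copies_def using finite_partitions_le by (intro Max_ge) auto
  then show ?thesis by (simp add: copies_canonize)
qed

lemma max_copies_attained:
  assumes "k \<ge> 1"
  obtains w :: "nat list" where "length w = n" "card (set w) \<le> k" "copies m S w = max_copies m S n k"
proof -
  have "max_copies m S n k \<in> copies m S ` partitions_le n k"
    unfolding max_copies_def
    using finite_partitions_le partitions_le_nonempty[OF assms] by (intro Max_in) auto
  then show ?thesis
    using that by (auto simp: partitions_le_eq partitions_eq)
qed

lemma max_density_ge_length:
  assumes "n \<le> k"
  shows "max_density m S n k = max_density m S n n"
proof -
  have "partitions_le n k = partitions_le n n"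
    using assms by (auto simp: partitions_le_eq partitions_eq intro: order.trans[OF card_length])
  then show ?thesis by (simp add: max_density_def)
qed

lemma max_density_le_diagonal:
  assumes "k \<ge> 1"
  shows "max_density m S n k \<le> max_density m S n n"
proof -
  obtain w :: "nat list" where w: "length w = n" "copies m S w = max_copies m S n k"
    using max_copies_attained[OF assms] by metis
  then have "max_copies m S n k \<le> max_copies m S n n"
    using copies_le_max_copies[of w n n m S] card_length[of w] by simp
  then show ?thesis
    by (simp add: max_density_eq divide_right_mono)
qed

section \<open>Deleting a letter\<close>

lemma occurrences_avoiding_le_copies_delete:
  assumes "j < length w"
  shows "card {I \<in> occurrences m S w. j \<notin> I} \<le> copies m S (take j w @ drop (Suc j) w)"
  unfolding copies_eq_card_occurrences
proof (rule card_inj_on_le)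
  let ?h = "\<lambda>i. if i < j then i else i - 1"
  let ?v = "take j w @ drop (Suc j) w"
  have mono: "strict_mono_on (- {j}) ?h"
    by (auto simp: strict_mono_on_def)
  then have inj: "inj_on ?h (- {j})"
    by (rule strict_mono_on_imp_inj_on)
  show "inj_on (image ?h) {I \<in> occurrences m S w. j \<notin> I}"
    by (rule inj_on_subset[OF inj_on_image_Pow[OF inj]]) auto
  show "image ?h ` {I \<in> occurrences m S w. j \<notin> I} \<subseteq> occurrences m S ?v"
  proof safe
    fix I assume I: "I \<in> occurrences m S w" "j \<notin> I"
    show "?h ` I \<in> occurrences m S ?v"
    proof (rule image_in_occurrences[OF I(1)])
      show "strict_mono_on I ?h"
        using I(2) by (intro monotone_on_subset[OF mono]) auto
    next
      fix i assume "i \<in> I"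
      then have "i < length w" "i \<noteq> j"
        using I by (auto simp: occurrences_def)
      then show "?h i < length ?v \<and> ?v ! ?h i = w ! i"
        using assms by (auto simp: nth_append min_def)
    qed
  qed
qed (rule finite_occurrences)

text \<open>Every occurrence survives the deletion of each of the \<open>n + 1 - m\<close> letters that it does not use;
  summing over all \<open>n + 1\<close> deletions gives the bound.\<close>

lemma max_copies_Suc_le:
  assumes "k \<ge> 1"
  shows "(Suc n - m) * max_copies m S (Suc n) k \<le> Suc n * max_copies m S n k"
proof -
  obtain w :: "nat list" where w: "length w = Suc n" "card (set w) \<le> k"
      "copies m S w = max_copies m S (Suc n) k"
    using max_copies_attained[OF assms] by metis
  have "(Suc n - m) * card (occurrences m S w)
      = (\<Sum>j<Suc n. card {I \<in> occurrences m S w. j \<notin> I})"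
  proof (rule sum_multicount[symmetric])
    show "\<forall>I\<in>occurrences m S w. card {j \<in> {..<Suc n}. j \<notin> I} = Suc n - m"
    proof
      fix I assume I: "I \<in> occurrences m S w"
      have "{j \<in> {..<Suc n}. j \<notin> I} = {..<Suc n} - I" by auto
      moreover have "I \<subseteq> {..<Suc n}" "card I = m"
        using I w(1) by (auto simp: occurrences_def)
      ultimately show "card {j \<in> {..<Suc n}. j \<notin> I} = Suc n - m"
        using finite_occurrence[OF I] by (simp add: card_Diff_subset)
    qed
  qed (simp_all add: finite_occurrences)
  also have "\<dots> \<le> (\<Sum>j<Suc n. max_copies m S n k)"
  proof (rule sum_mono)
    fix j assume "j \<in> {..<Suc n}"
    then have j: "j < length w" using w(1) by simp
    let ?v = "take j w @ drop (Suc j) w"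
    have "set ?v \<subseteq> set w"
      by (auto dest: in_set_takeD in_set_dropD)
    then have "card (set ?v) \<le> k"
      using w(2) card_mono[of "set w" "set ?v"] by simp
    moreover have "length ?v = n" using j w(1) by simp
    ultimately have "copies m S ?v \<le> max_copies m S n k"
      by (rule copies_le_max_copies)
    then show "card {I \<in> occurrences m S w. j \<notin> I} \<le> max_copies m S n k"
      using occurrences_avoiding_le_copies_delete[OF j, of m S] by linarith
  qed
  finally show ?thesis
    using w(3) by (simp add: copies_eq_card_occurrences)
qed

lemma max_density_Suc_le:
  assumes "k \<ge> 1" "m \<le> n"
  shows "max_density m S (Suc n) k \<le> max_density m S n k"
proof -
  have pos: "0 < Suc n choose m" "0 < n choose m" "0 < Suc n - m"
    using assms(2) by simp_all
  have absorb: "(Suc n - m) * (Suc n choose m) = Suc n * (n choose m)"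
    using binomial_absorb_comp[of "Suc n" m] by simp
  have "(Suc n - m) * (max_copies m S (Suc n) k * (n choose m))
      \<le> Suc n * max_copies m S n k * (n choose m)"
    using mult_right_mono[OF max_copies_Suc_le[OF assms(1), of n m S], of "n choose m"]
    by (simp only: mult.assoc)
  also have "\<dots> = max_copies m S n k * (Suc n * (n choose m))"
    by (simp only: ac_simps)
  also have "\<dots> = (Suc n - m) * (max_copies m S n k * (Suc n choose m))"
    by (simp only: absorb[symmetric] ac_simps)
  finally have "max_copies m S (Suc n) k * (n choose m) \<le> max_copies m S n k * (Suc n choose m)"
    using pos(3) by simp
  then have "real (max_copies m S (Suc n) k) * real (n choose m)
      \<le> real (max_copies m S n k) * real (Suc n choose m)"
    unfolding of_nat_mult[symmetric] of_nat_le_iff .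
  then show ?thesis
    using pos(1,2) by (simp add: max_density_eq divide_simps del: binomial_Suc_n)
qed

section \<open>Blowing up a word\<close>

definition blow_up :: "nat \<Rightarrow> 'a list \<Rightarrow> 'a list" where
  "blow_up N w = map (\<lambda>i. w ! (i div N)) [0..<length w * N]"

lemma length_blow_up [simp]: "length (blow_up N w) = length w * N"
  by (simp add: blow_up_def)

lemma block_index_less:
  fixes i r N n :: nat
  assumes "i < n" "r < N"
  shows "i * N + r < n * N"
proof -
  have "i * N + r < Suc i * N" using assms(2) by simp
  also have "\<dots> \<le> n * N" using assms(1) by (intro mult_right_mono) auto
  finally show ?thesis .
qed

lemma nth_blow_up:
  assumes "i < length w" "r < N"
  shows "blow_up N w ! (i * N + r) = w ! i"
  using block_index_less[OF assms] assms(2) by (simp add: blow_up_def)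

lemma set_blow_up_subset: "set (blow_up N w) \<subseteq> set w"
  by (auto simp: blow_up_def less_mult_imp_div_less)

text \<open>An occurrence in \<open>w\<close> together with a choice, at each of its \<open>m\<close> positions, of one of the \<open>N\<close>
  duplicates of the letter there is an occurrence in the blow-up, and different choices give different
  occurrences.\<close>

lemma copies_blow_up_ge: "copies m S w * N ^ m \<le> copies m S (blow_up N w)"
proof -
  let ?P = "SIGMA I:occurrences m S w. I \<rightarrow>\<^sub>E {..<N}"
  let ?F = "\<lambda>(I, f). (\<lambda>i. i * N + f i) ` I"
  have "card (I \<rightarrow>\<^sub>E {..<N}) = N ^ m" if "I \<in> occurrences m S w" for I
    using that finite_occurrence[OF that] by (simp add: card_PiE occurrences_def)
  then have "card ?P = copies m S w * N ^ m"
    using finite_occurrences[of m S w] finite_occurrence[of _ m S w]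
    by (simp add: card_SigmaI finite_PiE copies_eq_card_occurrences)
  moreover have "card ?P \<le> card (occurrences m S (blow_up N w))"
  proof (rule card_inj_on_le)
    show "inj_on ?F ?P"
    proof (rule inj_onI, clarify)
      fix I f J g
      assume f: "f \<in> I \<rightarrow>\<^sub>E {..<N}" and g: "g \<in> J \<rightarrow>\<^sub>E {..<N}"
        and eq: "(\<lambda>i. i * N + f i) ` I = (\<lambda>i. i * N + g i) ` J"
      \<comment> \<open>Division by \<open>N\<close> with remainder recovers the original position and the chosen duplicate.\<close>
      have decode: "(i * N + f i) div N = i" "(i * N + f i) mod N = f i" if "i \<in> I" for i
        using PiE_mem[OF f that] by auto
      have decode': "(i * N + g i) div N = i" "(i * N + g i) mod N = g i" if "i \<in> J" for i
        using PiE_mem[OF g that] by auto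
      have "I = (\<lambda>x. x div N) ` (\<lambda>i. i * N + f i) ` I"
        using decode by (force simp: image_image)
      also have "\<dots> = J"
        unfolding eq using decode' by (force simp: image_image)
      finally have "I = J" .
      moreover have "f i = g i" if "i \<in> I" for i
      proof -
        have "i * N + f i \<in> (\<lambda>i. i * N + g i) ` J"
          using that eq by blast
        then obtain i' where "i' \<in> J" "i * N + f i = i' * N + g i'"
          by auto
        then show ?thesis
          using decode[OF that] decode'[of i'] by metis
      qed
      ultimately show "I = J \<and> f = g"
        using f g by (blast intro: PiE_ext)
    qed
    show "?F ` ?P \<subseteq> occurrences m S (blow_up N w)"
    proof clarify
      fix I f assume I: "I \<in> occurrences m S w" and f: "f \<in> I \<rightarrow>\<^sub>E {..<N}"
      show "(\<lambda>i. i * N + f i) ` I \<in> occurrences m S (blow_up N w)"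
      proof (rule image_in_occurrences[OF I])
        show "strict_mono_on I (\<lambda>i. i * N + f i)"
        proof (rule strict_mono_onI)
          fix i j assume "i \<in> I" "j \<in> I" "i < j"
          then have "i * N + f i < j * N"
            using PiE_mem[OF f] by (intro block_index_less) auto
          then show "i * N + f i < j * N + f j" by simp
        qed
      next
        fix i assume "i \<in> I"
        then have "i < length w" "f i < N"
          using I PiE_mem[OF f] by (auto simp: occurrences_def)
        then show "i * N + f i < length (blow_up N w) \<and> blow_up N w ! (i * N + f i) = w ! i"
          by (simp add: block_index_less nth_blow_up)
      qed
    qed
  qed (rule finite_occurrences)
  ultimately show ?thesis
    by (simp add: copies_eq_card_occurrences)
qed

text \<open>The probability that \<open>m\<close> independent uniform draws from \<open>n\<close> positions are distinct.\<close>

definition distinct_ratio :: "nat \<Rightarrow> nat \<Rightarrow> real" where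
  "distinct_ratio m n = real (n choose m) * fact m / real n ^ m"

text \<open>The factor \<open>N ^ m\<close> gained by the blow-up cancels against the bound \<open>(n * N) ^ m / m!\<close> for the
  number of \<open>m\<close>-subsets of positions, so what is lost does not depend on \<open>N\<close>.\<close>

lemma max_density_blow_up:
  assumes "n \<ge> 1" "m \<le> n" "N \<ge> 1"
  shows "distinct_ratio m n * max_density m S n n \<le> max_density m S (n * N) n"
proof -
  obtain w :: "nat list" where w: "length w = n" "card (set w) \<le> n"
      "copies m S w = max_copies m S n n"
    using max_copies_attained[OF assms(1)] by metis
  have "card (set (blow_up N w)) \<le> n"
    using w(2) card_mono[OF _ set_blow_up_subset[of N w]] by simp
  then have "max_copies m S n n * N ^ m \<le> max_copies m S (n * N) n"
    using copies_le_max_copies[of "blow_up N w" n "n * N" m S] copies_blow_up_ge[of m S w N] w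
    by simp
  then have num: "real (max_copies m S n n) * real N ^ m \<le> real (max_copies m S (n * N) n)"
    by (metis of_nat_le_iff of_nat_mult of_nat_power)
  have "(n * N choose m) * fact m \<le> (n * N) ^ m"
    by (rule binomial_fact_pow)
  then have "real ((n * N choose m) * fact m) \<le> real ((n * N) ^ m)"
    by (simp only: of_nat_le_iff)
  then have den: "real (n * N choose m) * fact m \<le> real n ^ m * real N ^ m"
    by (simp add: power_mult_distrib)
  have "n * 1 \<le> n * N"
    using assms(3) by (intro mult_left_mono) auto
  then have pos: "0 < real (n * N choose m)" "0 < real (n choose m)" "0 < real n" "0 < real N"
    using assms by (auto intro: order.trans)
  have "distinct_ratio m n * max_density m S n n = real (max_copies m S n n) * fact m / real n ^ m"
    using pos(2) by (simp add: distinct_ratio_def max_density_eq)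
  also have "\<dots> = real (max_copies m S n n) * real N ^ m * fact m / (real n ^ m * real N ^ m)"
    using pos(4) by simp
  also have "\<dots> \<le> real (max_copies m S n n) * real N ^ m * fact m / (real (n * N choose m) * fact m)"
    using den pos by (intro divide_left_mono) auto
  also have "\<dots> = real (max_copies m S n n) * real N ^ m / real (n * N choose m)"
    by simp
  also have "\<dots> \<le> max_density m S (n * N) n"
    unfolding max_density_eq using num by (rule divide_right_mono) simp
  finally show ?thesis .
qed

lemma distinct_ratio_tendsto: "distinct_ratio m \<longlonglongrightarrow> 1"
proof -
  have "(\<lambda>n. \<Prod>i<m. 1 - real i / real n) \<longlonglongrightarrow> (\<Prod>i<m. 1 - 0)"
    by (intro tendsto_prod tendsto_diff tendsto_const lim_const_over_n)
  moreover have "\<forall>\<^sub>F n in sequentially. (\<Prod>i<m. 1 - real i / real n) = distinct_ratio m n"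
    using eventually_gt_at_top[of 0]
  proof eventually_elim
    fix n :: nat assume n: "0 < n"
    have "(\<Prod>i<m. 1 - real i / real n) = (\<Prod>i<m. (real n - real i) / real n)"
      using n by (intro prod.cong) (auto simp: field_simps)
    also have "\<dots> = (\<Prod>i<m. real n - real i) / real n ^ m"
      by (simp add: prod_dividef)
    also have "(\<Prod>i<m. real n - real i) = real (n choose m) * fact m"
      by (simp add: binomial_gbinomial gbinomial_prod_rev atLeast0LessThan)
    finally show "(\<Prod>i<m. 1 - real i / real n) = distinct_ratio m n"
      by (simp add: distinct_ratio_def)
  qed
  ultimately show ?thesis
    by (auto intro: Lim_transform_eventually)
qed

section \<open>Exchanging the limits\<close>

lemma eventually_decreasing_convergent:
  fixes f :: "nat \<Rightarrow> real"
  assumes dec: "\<And>n. n \<ge> n0 \<Longrightarrow> f (Suc n) \<le> f n" and nonneg: "\<And>n. 0 \<le> f n"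
  shows "convergent f" and "n \<ge> n0 \<Longrightarrow> lim f \<le> f n"
proof -
  have "decseq (\<lambda>n. f (n + n0))"
    using dec by (intro decseq_SucI) simp
  then obtain L where L: "(\<lambda>n. f (n + n0)) \<longlonglongrightarrow> L" "\<And>n. L \<le> f (n + n0)"
    using decseq_convergent[of "\<lambda>n. f (n + n0)" 0] nonneg by metis
  then have "f \<longlonglongrightarrow> L"
    using LIMSEQ_offset by blast
  then show "convergent f" "n \<ge> n0 \<Longrightarrow> lim f \<le> f n"
    using L(2)[of "n - n0"] by (auto simp: convergent_def limI)
qed

theorem theorem1p5:
  fixes m :: nat and S :: "nat list set"
  assumes "S \<subseteq> partitions m"
  shows "(\<forall>n\<ge>m. convergent (\<lambda>k. max_density m S n k))
    \<and> convergent (\<lambda>n. lim (\<lambda>k. max_density m S n k))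
    \<and> (\<forall>k\<ge>1. convergent (\<lambda>n. max_density m S n k))
    \<and> convergent (\<lambda>k. lim (\<lambda>n. max_density m S n k))
    \<and> packing_density m S = packing_density' m S"
proof -
  let ?d = "max_density m S"
  have nonneg: "0 \<le> ?d n k" for n k
    by (simp add: max_density_eq)

  have inner: "(\<lambda>k. ?d n k) \<longlonglongrightarrow> ?d n n" for n
  proof (rule tendsto_eventually)
    show "\<forall>\<^sub>F k in sequentially. ?d n k = ?d n n"
      using eventually_ge_at_top[of n] by eventually_elim (rule max_density_ge_length)
  qed
  then have lim_inner: "(\<lambda>n. lim (\<lambda>k. ?d n k)) = (\<lambda>n. ?d n n)"
    by (intro ext limI)

  have "?d (Suc n) (Suc n) \<le> ?d n n" if "n \<ge> m" for n
    using max_density_Suc_le[OF _ that, of "Suc n" S] max_density_ge_length[of n "Suc n" m S] by simp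
  then have diag: "convergent (\<lambda>n. ?d n n)"
    using eventually_decreasing_convergent(1)[of m "\<lambda>n. ?d n n"] nonneg by blast
  then obtain \<delta> where \<delta>: "(\<lambda>n. ?d n n) \<longlonglongrightarrow> \<delta>"
    by (auto simp: convergent_def)

  have conv: "convergent (\<lambda>n. ?d n k)" if "k \<ge> 1" for k
    using eventually_decreasing_convergent(1)[of m "\<lambda>n. ?d n k"] max_density_Suc_le[OF that] nonneg
    by blast

  have upper: "lim (\<lambda>n. ?d n k) \<le> \<delta>" if "k \<ge> 1" for k
  proof (rule LIMSEQ_le[OF _ \<delta>])
    show "(\<lambda>n. ?d n k) \<longlonglongrightarrow> lim (\<lambda>n. ?d n k)"
      using conv[OF that] by (rule convergent_LIMSEQ_iff[THEN iffD1])
    show "\<exists>N. \<forall>n\<ge>N. ?d n k \<le> ?d n n"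
      using max_density_le_diagonal[OF that] by blast
  qed

  \<comment> \<open>The blow-ups control only the lengths \<open>k * N\<close>, which suffices because the limit in \<open>n\<close> exists.\<close>
  have lower: "distinct_ratio m k * ?d k k \<le> lim (\<lambda>n. ?d n k)" if "k \<ge> 1" "k \<ge> m" for k
  proof (rule LIMSEQ_le_const)
    have "strict_mono (\<lambda>N. k * N)"
      using that(1) by (simp add: strict_mono_def)
    then show "(\<lambda>N. ?d (k * N) k) \<longlonglongrightarrow> lim (\<lambda>n. ?d n k)"
      using LIMSEQ_subseq_LIMSEQ[of "\<lambda>n. ?d n k"] conv[OF that(1)]
      by (simp add: convergent_LIMSEQ_iff o_def)
    show "\<exists>N0. \<forall>N\<ge>N0. distinct_ratio m k * ?d k k \<le> ?d (k * N) k"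
      using max_density_blow_up that by blast
  qed

  have outer: "(\<lambda>k. lim (\<lambda>n. ?d n k)) \<longlonglongrightarrow> \<delta>"
  proof (rule tendsto_sandwich)
    show "(\<lambda>k. distinct_ratio m k * ?d k k) \<longlonglongrightarrow> \<delta>"
      using tendsto_mult[OF distinct_ratio_tendsto \<delta>] by simp
    show "\<forall>\<^sub>F k in sequentially. distinct_ratio m k * ?d k k \<le> lim (\<lambda>n. ?d n k)"
      using eventually_ge_at_top[of "max 1 m"] by eventually_elim (simp add: lower)
    show "\<forall>\<^sub>F k in sequentially. lim (\<lambda>n. ?d n k) \<le> \<delta>"
      using eventually_ge_at_top[of 1] by eventually_elim (rule upper)
  qed simp

  have "packing_density m S = \<delta>" "packing_density' m S = \<delta>"
    unfolding packing_density_def packing_density'_def lim_inner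
    using \<delta> outer by (simp_all add: limI)
  then show ?thesis
    using inner diag conv outer unfolding lim_inner by (auto simp: convergent_def)
qed

end
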